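(* Let $p\ge 1$ and let $f\in\mathfrak W^{p\times p}$ be such that $f(Z)$ is invertible in $\mathbb{BC}^{p\times p}$ for every $Z\in\partial\mathbb K$. Then $f$ is invertible in $\mathfrak W^{p\times p}$.
   Context: $\mathbb{BC}$ is the commutative algebra of bicomplex numbers $Z=z_1+jz_2$, $z_1,z_2\in\mathbb C$ (imaginary unit $i$), where $j^2=-1$ and $ij=ji=:k$ (so $k^2=1$). Put $\mathbf e_1=\frac{1+k}{2}$, $\mathbf e_2=\frac{1-k}{2}$; these are idempotents with $\mathbf e_1\mathbf e_2=0$, $\mathbf e_1+\mathbf e_2=1$, and every $Z=z_1+jz_2$ is uniquely $Z=\lambda_1\mathbf e_1+\lambda_2\mathbf e_2$ with $\lambda_1=z_1-iz_2$, $\lambda_2=z_1+iz_2\in\mathbb C$. Similarly every $M\in\mathbb{BC}^{p\times p}$ is uniquely $M=M_1\mathbf e_1+M_2\mathbf e_2$ with $M_1,M_2\in\mathbb C^{p\times p}$, sums and products being componentwise; its norm is $\|M\|=\|M_1\|+\|M_2\|$ (operator norms of complex matrices). The bicomplex unit circle is $\partial\mathbb K=\{e^{it}e^{js}: t,s\in[0,2\pi]\}\subset\mathbb{BC}$, where $e^{js}=\cos s+j\sin s$ (equivalently the set of $Z$ with $|\lambda_1|=|\lambda_2|=1$). The bicomplex Wiener algebra $\mathfrak W^{p\times p}$ consists of the functions on $\partial\mathbb K$ of the form $f(Z)=\sum_{n\in\mathbb Z}f_nZ^n$ with $f_n\in\mathbb{BC}^{p\times p}$ and $\sum_{n\in\mathbb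 Z}\|f_n\|<\infty$, endowed with pointwise multiplication and norm $\|f\|=\sum_n\|f_n\|$. *)

theory Defs
  imports "HOL-Analysis.Analysis"
begin

text \<open>\<open>Bicomplex z1 z2\<close> represents $z_1 + j z_2$.\<close>

datatype bicomplex = Bicomplex (bc_fst: complex) (bc_snd: complex)

lemma bicomplex_eq_iff: "Z = W \<longleftrightarrow> bc_fst Z = bc_fst W \<and> bc_snd Z = bc_snd W"
  by (cases Z; cases W) auto

instantiation bicomplex :: comm_ring_1
begin

definition zero_bicomplex :: bicomplex where "0 = Bicomplex 0 0"
definition one_bicomplex :: bicomplex where "1 = Bicomplex 1 0"
definition plus_bicomplex :: "bicomplex \<Rightarrow> bicomplex \<Rightarrow> bicomplex" where
  "Z + W = Bicomplex (bc_fst Z + bc_fst W) (bc_snd Z + bc_snd W)"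
definition uminus_bicomplex :: "bicomplex \<Rightarrow> bicomplex" where
  "- Z = Bicomplex (- bc_fst Z) (- bc_snd Z)"
definition minus_bicomplex :: "bicomplex \<Rightarrow> bicomplex \<Rightarrow> bicomplex" where
  "Z - W = Bicomplex (bc_fst Z - bc_fst W) (bc_snd Z - bc_snd W)"
definition times_bicomplex :: "bicomplex \<Rightarrow> bicomplex \<Rightarrow> bicomplex" where
  "Z * W = Bicomplex (bc_fst Z * bc_fst W - bc_snd Z * bc_snd W)
                     (bc_fst Z * bc_snd W + bc_snd Z * bc_fst W)"

instance
  by standard
    (auto simp: bicomplex_eq_iff zero_bicomplex_def one_bicomplex_def plus_bicomplex_def
      uminus_bicomplex_def minus_bicomplex_def times_bicomplex_def algebra_simps)

end

text \<open>The inverse comes from $(z_1 + j z_2)(z_1 - j z_2) = z_1^2 + z_2^2$. It is the actual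
  inverse for units; on the (nonzero) zero divisors, where $z_1^2 + z_2^2 = 0$, it takes the
  value 0.\<close>

instantiation bicomplex :: inverse
begin

definition inverse_bicomplex :: "bicomplex \<Rightarrow> bicomplex" where
  "inverse Z = Bicomplex (bc_fst Z / ((bc_fst Z)\<^sup>2 + (bc_snd Z)\<^sup>2))
                         (- bc_snd Z / ((bc_fst Z)\<^sup>2 + (bc_snd Z)\<^sup>2))"
definition divide_bicomplex :: "bicomplex \<Rightarrow> bicomplex \<Rightarrow> bicomplex" where
  "Z div W = Z * inverse (W :: bicomplex)"

instance ..

end

text \<open>The idempotent components: $Z = \lambda_1 e_1 + \lambda_2 e_2$.\<close>

definition bc_lambda1 :: "bicomplex \<Rightarrow> complex" where
  "bc_lambda1 Z = bc_fst Z - \<i> * bc_snd Z"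

definition bc_lambda2 :: "bicomplex \<Rightarrow> complex" where
  "bc_lambda2 Z = bc_fst Z + \<i> * bc_snd Z"

lemma bicomplex_eq_iff_lambda:
  "Z = W \<longleftrightarrow> bc_lambda1 Z = bc_lambda1 W \<and> bc_lambda2 Z = bc_lambda2 W"
proof
  assume h: "bc_lambda1 Z = bc_lambda1 W \<and> bc_lambda2 Z = bc_lambda2 W"
  have "bc_fst V = (bc_lambda1 V + bc_lambda2 V) / 2"
    "bc_snd V = (bc_lambda2 V - bc_lambda1 V) / (2 * \<i>)" for V
    by (simp_all add: bc_lambda1_def bc_lambda2_def)
  with h show "Z = W"
    by (metis bicomplex_eq_iff)
qed simp

instantiation bicomplex :: real_algebra_1
begin

definition scaleR_bicomplex :: "real \<Rightarrow> bicomplex \<Rightarrow> bicomplex" where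
  "r *\<^sub>R Z = Bicomplex (r *\<^sub>R bc_fst Z) (r *\<^sub>R bc_snd Z)"

instance
  by standard
    (auto simp: bicomplex_eq_iff plus_bicomplex_def times_bicomplex_def scaleR_bicomplex_def
      scaleR_conv_of_real algebra_simps)

end

lemma bc_lambda_simps [simp]:
  "bc_lambda1 0 = 0" "bc_lambda2 0 = 0"
  "bc_lambda1 1 = 1" "bc_lambda2 1 = 1"
  "bc_lambda1 (Z + W) = bc_lambda1 Z + bc_lambda1 W"
  "bc_lambda2 (Z + W) = bc_lambda2 Z + bc_lambda2 W"
  "bc_lambda1 (- Z) = - bc_lambda1 Z" "bc_lambda2 (- Z) = - bc_lambda2 Z"
  "bc_lambda1 (Z - W) = bc_lambda1 Z - bc_lambda1 W"
  "bc_lambda2 (Z - W) = bc_lambda2 Z - bc_lambda2 W"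
  "bc_lambda1 (Z * W) = bc_lambda1 Z * bc_lambda1 W"
  "bc_lambda2 (Z * W) = bc_lambda2 Z * bc_lambda2 W"
  "bc_lambda1 (r *\<^sub>R Z) = r *\<^sub>R bc_lambda1 Z" "bc_lambda2 (r *\<^sub>R Z) = r *\<^sub>R bc_lambda2 Z"
  by (simp_all add: bc_lambda1_def bc_lambda2_def zero_bicomplex_def one_bicomplex_def
      plus_bicomplex_def uminus_bicomplex_def minus_bicomplex_def times_bicomplex_def
      scaleR_bicomplex_def scaleR_conv_of_real algebra_simps)

text \<open>The norm $|\lambda_1| + |\lambda_2|$ is the $1 \times 1$ case of the matrix norm below; it
  induces the usual topology of $\mathbf{C}^2$.\<close>

instantiation bicomplex :: real_normed_vector
begin

definition norm_bicomplex :: "bicomplex \<Rightarrow> real" where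
  "norm Z = norm (bc_lambda1 Z) + norm (bc_lambda2 Z)"
definition sgn_bicomplex :: "bicomplex \<Rightarrow> bicomplex" where
  "sgn (Z :: bicomplex) = Z /\<^sub>R norm Z"
definition dist_bicomplex :: "bicomplex \<Rightarrow> bicomplex \<Rightarrow> real" where
  "dist Z W = norm (Z - W :: bicomplex)"
definition uniformity_bicomplex :: "(bicomplex \<times> bicomplex) filter" where
  "uniformity_bicomplex = (INF e\<in>{0 <..}. principal {(x, y). dist x y < e})"
definition open_bicomplex :: "bicomplex set \<Rightarrow> bool" where
  "open_bicomplex U \<longleftrightarrow> (\<forall>x\<in>U. eventually (\<lambda>(x', y). x' = x \<longrightarrow> y \<in> U) uniformity)"

instance
proof
  fix Z W :: bicomplex and r :: real
  show "norm Z = 0 \<longleftrightarrow> Z = 0"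
    by (simp add: norm_bicomplex_def add_nonneg_eq_0_iff bicomplex_eq_iff_lambda)
  show "norm (Z + W) \<le> norm Z + norm W"
    using norm_triangle_ineq[of "bc_lambda1 Z" "bc_lambda1 W"]
      norm_triangle_ineq[of "bc_lambda2 Z" "bc_lambda2 W"]
    by (simp add: norm_bicomplex_def)
  show "norm (r *\<^sub>R Z) = \<bar>r\<bar> * norm Z"
    by (simp add: norm_bicomplex_def distrib_left)
qed (simp_all only: sgn_bicomplex_def dist_bicomplex_def uniformity_bicomplex_def
      open_bicomplex_def)

end

definition bc_of_complex :: "complex \<Rightarrow> bicomplex" where
  "bc_of_complex z = Bicomplex z 0"

definition bc_j :: bicomplex where
  "bc_j = Bicomplex 0 1"

definition bc_k :: bicomplex where
  "bc_k = bc_of_complex \<i> * bc_j"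

definition bc_e1 :: bicomplex where
  "bc_e1 = (1 + bc_k) /\<^sub>R 2"

definition bc_e2 :: bicomplex where
  "bc_e2 = (1 - bc_k) /\<^sub>R 2"

lemma bc_lambda_units [simp]:
  "bc_lambda1 (bc_of_complex z) = z" "bc_lambda2 (bc_of_complex z) = z"
  "bc_lambda1 bc_j = - \<i>" "bc_lambda2 bc_j = \<i>"
  "bc_lambda1 (of_real r) = of_real r" "bc_lambda2 (of_real r) = of_real r"
  "bc_lambda1 bc_e1 = 1" "bc_lambda2 bc_e1 = 0"
  "bc_lambda1 bc_e2 = 0" "bc_lambda2 bc_e2 = 1"
proof -
  show *: "bc_lambda1 (bc_of_complex z) = z" "bc_lambda2 (bc_of_complex z) = z"
    "bc_lambda1 bc_j = - \<i>" "bc_lambda2 bc_j = \<i>" for z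
    by (simp_all add: bc_lambda1_def bc_lambda2_def bc_of_complex_def bc_j_def)
  show **: "bc_lambda1 (of_real r) = of_real r" "bc_lambda2 (of_real r) = of_real r" for r
    by (simp_all add: of_real_def)
  show "bc_lambda1 bc_e1 = 1" "bc_lambda2 bc_e1 = 0"
    "bc_lambda1 bc_e2 = 0" "bc_lambda2 bc_e2 = 1"
    by (simp_all add: bc_e1_def bc_e2_def bc_k_def * ** scaleR_conv_of_real)
qed

lemma bc_j_squared: "bc_j * bc_j = - 1"
  by (simp add: bicomplex_eq_iff_lambda)

lemma bicomplex_decomp:
  "Z = bc_of_complex (bc_fst Z) + bc_j * bc_of_complex (bc_snd Z)"
  by (simp add: bicomplex_eq_iff_lambda) (simp add: bc_lambda1_def bc_lambda2_def)

lemma bicomplex_idempotent_decomp: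
  "Z = bc_of_complex (bc_lambda1 Z) * bc_e1 + bc_of_complex (bc_lambda2 Z) * bc_e2"
  by (simp add: bicomplex_eq_iff_lambda)

lemma bicomplex_inverse_unique:
  fixes Z W :: bicomplex
  assumes "Z * W = 1"
  shows "inverse Z = W"
proof -
  have ne: "(bc_fst Z)\<^sup>2 + (bc_snd Z)\<^sup>2 \<noteq> 0"
  proof -
    have "(bc_fst Z)\<^sup>2 + (bc_snd Z)\<^sup>2 = bc_lambda1 Z * bc_lambda2 Z"
      by (simp add: bc_lambda1_def bc_lambda2_def algebra_simps power2_eq_square)
    moreover have "bc_lambda1 Z * bc_lambda1 W = 1" "bc_lambda2 Z * bc_lambda2 W = 1"
      using arg_cong[OF assms, of bc_lambda1] arg_cong[OF assms, of bc_lambda2] by simp_all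
    ultimately show ?thesis
      by auto
  qed
  then have "Z * inverse Z = 1"
    by (simp add: bicomplex_eq_iff times_bicomplex_def inverse_bicomplex_def one_bicomplex_def
        power2_eq_square add_divide_distrib[symmetric])
  then show ?thesis
    using assms by (metis mult.assoc mult.commute mult_1)
qed

definition bc_unit_circle :: "bicomplex set" where
  "bc_unit_circle =
     {bc_of_complex (exp (\<i> * of_real t)) * (of_real (cos s) + bc_j * of_real (sin s)) | t s.
        t \<in> {0..2 * pi} \<and> s \<in> {0..2 * pi}}"

lemma bc_unit_circle_iff:
  "Z \<in> bc_unit_circle \<longleftrightarrow> norm (bc_lambda1 Z) = 1 \<and> norm (bc_lambda2 Z) = 1"
proof
  assume "Z \<in> bc_unit_circle"
  then obtain t s where
    "Z = bc_of_complex (exp (\<i> * of_real t)) * (of_real (cos s) + bc_j * of_real (sin s))"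
    by (auto simp: bc_unit_circle_def)
  then have "bc_lambda1 Z = cis t * cis (- s)" "bc_lambda2 Z = cis t * cis s"
    by (auto simp: cis_conv_exp[symmetric] complex_eq_iff)
  then show "norm (bc_lambda1 Z) = 1 \<and> norm (bc_lambda2 Z) = 1"
    by (simp add: norm_mult)
next
  assume h: "norm (bc_lambda1 Z) = 1 \<and> norm (bc_lambda2 Z) = 1"
  obtain a where a: "0 \<le> a" "a < 2 * pi" "bc_lambda1 Z = cis a"
    using complex_unimodular_polar[of "bc_lambda1 Z"] h by (auto simp: complex_eq_iff)
  obtain b where b: "0 \<le> b" "b < 2 * pi" "bc_lambda2 Z = cis b"
    using complex_unimodular_polar[of "bc_lambda2 Z"] h by (auto simp: complex_eq_iff)
  define t where "t = (a + b) / 2"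
  define r where "r = (b - a) / 2"
  define s where "s = (if r < 0 then r + 2 * pi else r)"
  have s: "cos s = cos r" "sin s = sin r"
    by (auto simp: s_def)
  have "t \<in> {0..2 * pi}" "s \<in> {0..2 * pi}"
    using a b by (auto simp: t_def s_def r_def field_simps)
  moreover have "Z = bc_of_complex (exp (\<i> * of_real t)) * (of_real (cos s) + bc_j * of_real (sin s))"
  proof -
    have "cis a = cis t * cis (- r)" "cis b = cis t * cis r"
      by (simp_all add: cis_mult t_def r_def field_simps)
    moreover have "cis (- r) = of_real (cos r) - \<i> * of_real (sin r)"
      "cis r = of_real (cos r) + \<i> * of_real (sin r)"
      by (simp_all add: complex_eq_iff)
    ultimately show ?thesis
      by (simp add: bicomplex_eq_iff_lambda a b s cis_conv_exp[symmetric])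
  qed
  ultimately show "Z \<in> bc_unit_circle"
    unfolding bc_unit_circle_def by blast
qed

text \<open>\<open>map_matrix bc_lambda1 M\<close> and \<open>map_matrix bc_lambda2 M\<close> are the complex matrices $M_1, M_2$
  with $M = M_1 e_1 + M_2 e_2$; \<open>onorm\<close> is taken with respect to the Euclidean norm. The type
  class norm on \<open>bicomplex ^ 'p ^ 'p\<close> is a different (equivalent) one, of which only the
  topology is used.\<close>

definition bc_mat_norm :: "bicomplex ^ 'p ^ 'p \<Rightarrow> real" where
  "bc_mat_norm M =
     onorm ((*v) (map_matrix bc_lambda1 M)) + onorm ((*v) (map_matrix bc_lambda2 M))"

text \<open>Elements of the algebra are functions on \<open>bc_unit_circle\<close>; values elsewhere are
  irrelevant.\<close>

definition bc_wiener :: "(bicomplex \<Rightarrow> bicomplex ^ 'p ^ 'p) set" where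
  "bc_wiener = {f. \<exists>a :: int \<Rightarrow> bicomplex ^ 'p ^ 'p.
     (\<lambda>n. bc_mat_norm (a n)) summable_on UNIV \<and>
     (\<forall>Z\<in>bc_unit_circle.
        ((\<lambda>n. map_matrix (\<lambda>x. x * (Z powi n)) (a n)) has_sum f Z) UNIV)}"

definition bc_wiener_invertible :: "(bicomplex \<Rightarrow> bicomplex ^ 'p ^ 'p) \<Rightarrow> bool" where
  "bc_wiener_invertible f \<longleftrightarrow>
     f \<in> bc_wiener \<and>
     (\<exists>g\<in>bc_wiener. \<forall>Z\<in>bc_unit_circle. f Z ** g Z = mat 1 \<and> g Z ** f Z = mat 1)"

end

theory Submission
  imports Defs "HOL-Computational_Algebra.Fundamental_Theorem_Algebra"
begin

text \<open>
  The idempotent components of a bicomplex Wiener function are complex matrix functions of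
  $\lambda_1$ and $\lambda_2$ separately, so by Cramer's rule everything reduces to Wiener's
  $1/f$ theorem for scalar functions on the complex unit circle. That theorem follows Newman's
  argument: if $|f| \ge 4\delta$ on the circle, choose a polynomial $p$ and an exponent $m$ with
  $\|p - z^m f\| \le \delta$ and expand $1/(z^m f) = \sum_n (p - z^m f)^n p^{-n-1}$. Since
  $|p| > 2\delta$ on a whole annulus around the circle, Cauchy's estimates bound the Wiener norm
  of $p^{-n}$ by $C (2\delta)^{-n}$, and the series converges. The Laurent expansion of $p^{-n}$
  on the annulus comes from factoring $p$ into linear factors.
\<close>

section \<open>Absolutely convergent Laurent series on an annulus\<close>

text \<open>The region is symmetric under inversion, so \<open>z powi n\<close> is bounded by
  \<open>r ^ nat \<bar>n\<bar>\<close> for exponents of either sign. For \<open>r = 1\<close> it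
  degenerates to the unit circle.\<close>

definition annulus :: "real \<Rightarrow> complex set" where
  "annulus r = {z. 1 / r \<le> norm z \<and> norm z \<le> r}"

text \<open>The case \<open>r = 1\<close> is the Wiener norm on the unit circle.\<close>

definition laurent_le :: "real \<Rightarrow> real \<Rightarrow> (complex \<Rightarrow> complex) \<Rightarrow> bool" where
  "laurent_le r B g \<longleftrightarrow> (\<exists>c S. ((\<lambda>n::int. norm (c n) * r ^ nat \<bar>n\<bar>) has_sum S) UNIV \<and> S \<le> B \<and>
     (\<forall>z\<in>annulus r. ((\<lambda>n. c n * z powi n) has_sum g z) UNIV))"

lemma annulus_1: "annulus 1 = sphere 0 1"
  by (auto simp: annulus_def)

lemma annulus_nonzero: "z \<in> annulus r \<Longrightarrow> r \<ge> 1 \<Longrightarrow> z \<noteq> 0"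
  by (auto simp: annulus_def divide_le_0_iff)

lemma norm_powi_annulus_le:
  assumes "r \<ge> 1" "z \<in> annulus r"
  shows "norm (z powi n) \<le> r ^ nat \<bar>n\<bar>"
proof (cases "n \<ge> 0")
  case True
  then show ?thesis using assms
    by (auto simp: annulus_def power_int_def norm_power intro!: power_mono)
next
  case False
  have "z \<noteq> 0" using annulus_nonzero assms by blast
  moreover have "1 / r \<le> norm z" using assms by (simp add: annulus_def)
  ultimately have "inverse (norm z) \<le> r" using assms by (simp add: field_simps)
  then show ?thesis using False
    by (auto simp: power_int_def norm_power norm_inverse intro!: power_mono)
qed

lemma laurent_le_mono: "laurent_le r B g \<Longrightarrow> B \<le> B' \<Longrightarrow> laurent_le r B' g"
  unfolding laurent_le_def by (meson order_trans)

lemma laurent_le_cong: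
  "laurent_le r B g \<Longrightarrow> (\<And>z. z \<in> annulus r \<Longrightarrow> g z = h z) \<Longrightarrow> laurent_le r B h"
  unfolding laurent_le_def by fastforce

lemma laurent_le_nonneg:
  assumes "laurent_le r B g" "r \<ge> 1"
  shows "B \<ge> 0"
proof -
  obtain c S where "((\<lambda>n::int. norm (c n :: complex) * r ^ nat \<bar>n\<bar>) has_sum S) UNIV" "S \<le> B"
    using assms(1) unfolding laurent_le_def by blast
  moreover from this(1) have "S \<ge> 0"
    by (rule has_sum_nonneg) (use assms(2) in auto)
  ultimately show ?thesis by linarith
qed

text \<open>Fubini for an absolutely convergent double family: the coefficients of \<open>h\<close>
  are the sums over \<open>i\<close> of the coefficients of \<open>g i\<close>. Finite sums,
  products and geometric expansions are all obtained as instances of this one superposition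
  principle.\<close>

lemma laurent_le_has_sum:
  fixes g :: "'i \<Rightarrow> complex \<Rightarrow> complex"
  assumes r: "r \<ge> 1"
    and g: "\<And>i. i \<in> I \<Longrightarrow> laurent_le r (B i) (g i)"
    and B: "(B has_sum T) I"
    and h: "\<And>z. z \<in> annulus r \<Longrightarrow> ((\<lambda>i. g i z) has_sum h z) I"
  shows "laurent_le r T h"
proof -
  define w where "w n = r ^ nat \<bar>n\<bar>" for n :: int
  have w: "w n > 0" for n using r by (simp add: w_def)
  have "\<forall>i\<in>I. \<exists>c S. ((\<lambda>n. norm (c n) * w n) has_sum S) UNIV \<and> S \<le> B i \<and>
     (\<forall>z\<in>annulus r. ((\<lambda>n. c n * z powi n) has_sum g i z) UNIV)"
    using g unfolding laurent_le_def w_def by blast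
  then obtain c S where cS: "\<And>i. i \<in> I \<Longrightarrow> ((\<lambda>n. norm (c i n) * w n) has_sum S i) UNIV"
    and SB: "\<And>i. i \<in> I \<Longrightarrow> S i \<le> B i"
    and cg: "\<And>i z. i \<in> I \<Longrightarrow> z \<in> annulus r \<Longrightarrow> ((\<lambda>n. c i n * z powi n) has_sum g i z) UNIV"
    by metis
  have S0: "S i \<ge> 0" if "i \<in> I" for i
    using has_sum_nonneg[OF cS[OF that]] w by (simp add: less_imp_le)
  have sumS: "S summable_on I"
    by (rule summable_on_comparison_test[where f = B])
       (use B SB S0 in \<open>auto simp: summable_on_def\<close>)
  define U where "U = infsum S I"
  have SU: "(S has_sum U) I" using sumS by (simp add: U_def)
  have UT: "U \<le> T" using has_sum_mono[OF SU B] SB by blast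
  \<comment> \<open>The weighted norms form a nonnegative double family with summable row sums
    \<open>S i\<close>. It may therefore be summed by columns too, which controls the coefficients
    of \<open>h\<close>.\<close>
  define N where "N = (\<lambda>(i, n). norm (c i n) * w n)"
  have N0: "N x \<ge> 0" for x using w by (auto simp: N_def less_imp_le split: prod.splits)
  have Nsum: "N summable_on I \<times> UNIV"
    by (rule summable_on_SigmaI[where g = S]) (use cS sumS N0 in \<open>auto simp: N_def\<close>)
  have NU: "(N has_sum U) (I \<times> UNIV)"
    by (rule has_sum_SigmaI[OF _ SU Nsum]) (use cS in \<open>auto simp: N_def\<close>)
  have NU': "((\<lambda>(n, i). N (i, n)) has_sum U) (UNIV \<times> I)"
    using has_sum_swap[where f=N and S=U and A=I and B=UNIV] NU by simp
  have inner: "(\<lambda>i. norm (c i n) * w n) summable_on I" for n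
    using summable_on_SigmaD1[of "\<lambda>n i. N (i, n)" UNIV "\<lambda>_. I" n] NU'
    by (auto simp: N_def summable_on_def)
  have cn: "(\<lambda>i. norm (c i n)) summable_on I" for n
    using summable_on_cmult_left[OF inner[of n], of "inverse (w n)"] w[of n] by (simp add: mult.assoc)
  define d where "d n = infsum (\<lambda>i. c i n) I" for n
  have cd: "((\<lambda>i. c i n) has_sum d n) I" for n
    unfolding d_def using abs_summable_summable[OF cn] by simp
  define s where "s n = infsum (\<lambda>i. norm (c i n) * w n) I" for n
  have sU: "(s has_sum U) UNIV"
    by (rule has_sum_SigmaD[OF NU']) (use inner in \<open>auto simp: N_def s_def\<close>)
  have ds: "norm (d n) * w n \<le> s n" for n
  proof -
    have "s n = infsum (\<lambda>i. norm (c i n)) I * w n"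
      unfolding s_def by (rule infsum_cmult_left) (use cn in auto)
    then show ?thesis using norm_infsum_bound[OF cn[of n]] w[of n] by (simp add: d_def)
  qed
  have sd: "(\<lambda>n. norm (d n) * w n) summable_on UNIV"
    by (rule summable_on_comparison_test[where f = s])
       (use sU ds w in \<open>auto simp: summable_on_def less_imp_le\<close>)
  then have d1: "((\<lambda>n. norm (d n) * w n) has_sum infsum (\<lambda>n. norm (d n) * w n) UNIV) UNIV"
    by simp
  moreover have "infsum (\<lambda>n. norm (d n) * w n) UNIV \<le> T"
    using has_sum_mono[OF d1 sU] ds UT by fastforce
  moreover have "((\<lambda>n. d n * z powi n) has_sum h z) UNIV" if z: "z \<in> annulus r" for z
  proof -
    \<comment> \<open>\<open>N\<close> dominates this family of terms, so both orders of summation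
      agree: over \<open>n\<close> first it gives \<open>h z\<close>, over \<open>i\<close> first
      the series with coefficients \<open>d n\<close>.\<close>
    define G where "G = (\<lambda>(i, n). c i n * z powi n)"
    have "norm (G x) \<le> N x" for x
      using norm_powi_annulus_le[OF r z]
      by (auto simp: G_def N_def w_def norm_mult split: prod.splits intro!: mult_left_mono)
    then have "(\<lambda>x. norm (G x)) summable_on I \<times> UNIV"
      by (intro summable_on_comparison_test[OF Nsum]) auto
    then have "G summable_on I \<times> UNIV"
      by (rule abs_summable_summable)
    then have "(G has_sum h z) (I \<times> UNIV)"
      by (rule has_sum_SigmaI[OF _ h[OF z], rotated]) (use cg z in \<open>auto simp: G_def\<close>)
    then have "((\<lambda>(n, i). G (i, n)) has_sum h z) (UNIV \<times> I)"
      using has_sum_swap[where f=G and S="h z" and A=I and B=UNIV] by simp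
    then show ?thesis
      by (rule has_sum_SigmaD) (use cd in \<open>auto simp: G_def intro!: has_sum_cmult_left\<close>)
  qed
  ultimately show ?thesis unfolding laurent_le_def w_def by blast
qed

section \<open>Closure under the algebra operations\<close>

lemma laurent_le_monom_mult:
  assumes r: "r \<ge> 1" and g: "laurent_le r B g"
  shows "laurent_le r (norm a * r ^ nat \<bar>k\<bar> * B) (\<lambda>z. a * z powi k * g z)"
proof -
  obtain c S where S: "((\<lambda>n::int. norm (c n) * r ^ nat \<bar>n\<bar>) has_sum S) UNIV" "S \<le> B" and
     c: "\<And>z. z\<in>annulus r \<Longrightarrow> ((\<lambda>n. c n * z powi n) has_sum g z) UNIV"
    using g unfolding laurent_le_def by blast
  define d where "d n = a * c (n - k)" for n
  have shift: "bij_betw (\<lambda>n. n - k) UNIV (UNIV :: int set)"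
    by (rule bij_betwI[where g = "\<lambda>n. n + k"]) auto
  define M where "M = norm a * r ^ nat \<bar>k\<bar>"
  have "((\<lambda>n. M * (norm (c n) * r ^ nat \<bar>n\<bar>)) has_sum M * S) UNIV"
    by (rule has_sum_cmult_right[OF S(1)])
  then have MS: "((\<lambda>n. M * (norm (c (n - k)) * r ^ nat \<bar>n - k\<bar>)) has_sum M * S) UNIV"
    using has_sum_reindex_bij_betw[OF shift, of "\<lambda>n. M * (norm (c n) * r ^ nat \<bar>n\<bar>)"] by simp
  have le: "norm (d n) * r ^ nat \<bar>n\<bar> \<le> M * (norm (c (n - k)) * r ^ nat \<bar>n - k\<bar>)" for n
  proof -
    \<comment> \<open>Multiplying by \<open>z powi k\<close> shifts the coefficients by
      \<open>k\<close>. The weight is submultiplicative, since |n| \<le> |k| + |n - k|, so the shift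
      costs at most the factor \<open>r ^ nat \<bar>k\<bar>\<close>.\<close>
    have "r ^ nat \<bar>n\<bar> \<le> r ^ (nat \<bar>k\<bar> + nat \<bar>n - k\<bar>)"
      using r by (intro power_increasing) auto
    then have "norm (a * c (n - k)) * r ^ nat \<bar>n\<bar> \<le> norm (a * c (n - k)) * r ^ (nat \<bar>k\<bar> + nat \<bar>n - k\<bar>)"
      by (intro mult_left_mono) auto
    then show ?thesis by (simp add: d_def M_def norm_mult power_add mult_ac)
  qed
  have "(\<lambda>n. norm (d n) * r ^ nat \<bar>n\<bar>) summable_on UNIV"
    by (rule summable_on_comparison_test[where f = "\<lambda>n. M * (norm (c (n - k)) * r ^ nat \<bar>n - k\<bar>)"])
       (use MS le r in \<open>auto simp: summable_on_def\<close>)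
  then obtain S' where S': "((\<lambda>n. norm (d n) * r ^ nat \<bar>n\<bar>) has_sum S') UNIV"
    by (auto simp: summable_on_def)
  have "S' \<le> M * S" using has_sum_mono[OF S' MS] le by blast
  also have "\<dots> \<le> M * B" using S(2) r by (intro mult_left_mono) (auto simp: M_def)
  finally have "S' \<le> M * B" .
  moreover have "((\<lambda>n. d n * z powi n) has_sum a * z powi k * g z) UNIV" if z: "z \<in> annulus r" for z
  proof -
    have "((\<lambda>n. a * z powi k * (c (n - k) * z powi (n - k))) has_sum a * z powi k * g z) UNIV"
      using has_sum_cmult_right[OF c[OF z], of "a * z powi k"]
        has_sum_reindex_bij_betw[OF shift, of "\<lambda>n. a * z powi k * (c n * z powi n)"] by simp
    moreover have "a * z powi k * (c (n - k) * z powi (n - k)) = d n * z powi n" for n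
      using annulus_nonzero[OF z r] by (simp add: d_def power_int_diff)
    ultimately show ?thesis by simp
  qed
  ultimately show ?thesis unfolding laurent_le_def M_def using S' by blast
qed

lemma laurent_le_1: "laurent_le r 1 (\<lambda>z. 1)"
proof -
  define c where "c n = (if n = 0 then 1 else 0 :: complex)" for n :: int
  have "((\<lambda>n. norm (c n) * r ^ nat \<bar>n\<bar>) has_sum 1) UNIV"
    by (rule has_sum_finite_neutralI[of "{0}"]) (auto simp: c_def)
  moreover have "((\<lambda>n. c n * z powi n) has_sum 1) UNIV" for z
    by (rule has_sum_finite_neutralI[of "{0}"]) (auto simp: c_def)
  ultimately show ?thesis unfolding laurent_le_def by blast
qed

lemma laurent_le_monom:
  assumes "r \<ge> 1"
  shows "laurent_le r (norm a * r ^ nat \<bar>k\<bar>) (\<lambda>z. a * z powi k)"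
  using laurent_le_monom_mult[OF assms laurent_le_1, of a k] by simp

lemma laurent_le_const: "r \<ge> 1 \<Longrightarrow> laurent_le r (norm a) (\<lambda>z. a)"
  using laurent_le_monom[of r a 0] by simp

text \<open>Expanding only \<open>f\<close> writes the product as a superposition of monomial
  multiples of \<open>g\<close>, which avoids an explicit convolution of coefficients.\<close>

lemma laurent_le_mult:
  assumes r: "r \<ge> 1" and f: "laurent_le r A f" and g: "laurent_le r B g"
  shows "laurent_le r (A * B) (\<lambda>z. f z * g z)"
proof -
  obtain c S where S: "((\<lambda>n::int. norm (c n) * r ^ nat \<bar>n\<bar>) has_sum S) UNIV" "S \<le> A" and
     c: "\<And>z. z\<in>annulus r \<Longrightarrow> ((\<lambda>n. c n * z powi n) has_sum f z) UNIV"
    using f unfolding laurent_le_def by blast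
  have "laurent_le r (S * B) (\<lambda>z. f z * g z)"
    by (rule laurent_le_has_sum[OF r, where I = UNIV, OF laurent_le_monom_mult[OF r g]
          has_sum_cmult_left[OF S(1)] has_sum_cmult_left[OF c]])
  then show ?thesis
    by (rule laurent_le_mono) (use S laurent_le_nonneg[OF g r] in \<open>auto intro: mult_right_mono\<close>)
qed

lemma laurent_le_sum:
  assumes "r \<ge> 1" "finite I" "\<And>i. i \<in> I \<Longrightarrow> laurent_le r (B i) (g i)"
  shows "laurent_le r (\<Sum>i\<in>I. B i) (\<lambda>z. \<Sum>i\<in>I. g i z)"
  by (rule laurent_le_has_sum[of r I B g]) (use assms in \<open>auto intro: has_sum_finite\<close>)

lemma laurent_le_power:
  assumes "r \<ge> 1" "laurent_le r B g"
  shows "laurent_le r (B ^ n) (\<lambda>z. g z ^ n)"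
  by (induction n) (auto intro: laurent_le_1 laurent_le_mult assms)

lemma laurent_le_prod:
  assumes "r \<ge> 1" "finite I" "\<And>i. i \<in> I \<Longrightarrow> laurent_le r (B i) (g i)"
  shows "laurent_le r (\<Prod>i\<in>I. B i) (\<lambda>z. \<Prod>i\<in>I. g i z)"
  using assms(2,3) by (induction I rule: finite_induct) (auto intro!: laurent_le_1 laurent_le_mult assms(1))

lemma laurent_le_norm:
  assumes "r \<ge> 1" "laurent_le r B g" "z \<in> annulus r"
  shows "norm (g z) \<le> B"
proof -
  obtain c S where S: "((\<lambda>n::int. norm (c n) * r ^ nat \<bar>n\<bar>) has_sum S) UNIV" "S \<le> B" and
     c: "((\<lambda>n. c n * z powi n) has_sum g z) UNIV"
    using assms unfolding laurent_le_def by blast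
  have "norm (g z) \<le> S"
    by (rule norm_infsum_le[OF c S(1)])
       (auto simp: norm_mult intro!: mult_left_mono norm_powi_annulus_le assms)
  with S(2) show ?thesis by linarith
qed

section \<open>Reciprocals of polynomials without zeros in the annulus\<close>

lemma has_sum_geometric:
  fixes x :: "'a :: {real_normed_field, banach}"
  assumes "norm x < 1"
  shows "((\<lambda>n. x ^ n) has_sum 1 / (1 - x)) UNIV"
  by (rule norm_summable_imp_has_sum)
     (use assms geometric_sums in \<open>auto simp: norm_power intro!: summable_geometric\<close>)

text \<open>A pole outside the outer circle allows an expansion in powers of z/a, and a pole inside
  the inner circle one in powers of a/z. Both geometric series converge absolutely with the weights
  \<open>r ^ nat \<bar>n\<bar>\<close>.\<close>

lemma laurent_le_inverse_linear:
  assumes r: "r \<ge> 1" and a: "a \<notin> annulus r"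
  shows "\<exists>B. laurent_le r B (\<lambda>z. 1 / (z - a))"
proof (cases "norm a > r")
  case True
  then have a0: "a \<noteq> 0" using r by auto
  have "((\<lambda>n. norm (inverse a) * (r / norm a) ^ n) has_sum norm (inverse a) * (1 / (1 - r / norm a))) UNIV"
    by (intro has_sum_cmult_right has_sum_geometric) (use True r a0 in auto)
  moreover have "norm (inverse a) * (r / norm a) ^ n = norm (- (inverse a ^ Suc n)) * r ^ nat \<bar>int n\<bar>" for n
    by (simp add: norm_power norm_mult norm_inverse norm_divide power_divide field_simps)
  ultimately have B: "((\<lambda>n. norm (- (inverse a ^ Suc n)) * r ^ nat \<bar>int n\<bar>) has_sum
      norm (inverse a) * (1 / (1 - r / norm a))) UNIV" by simp
  have "((\<lambda>n. - (inverse a ^ Suc n) * z powi int n) has_sum 1 / (z - a)) UNIV"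
    if z: "z \<in> annulus r" for z
  proof -
    have "norm z < norm a" using z True by (simp add: annulus_def)
    then have "((\<lambda>n. - inverse a * (z / a) ^ n) has_sum - inverse a * (1 / (1 - z / a))) UNIV"
      by (intro has_sum_cmult_right has_sum_geometric) (use a0 in \<open>auto simp: norm_divide\<close>)
    moreover have "z - a \<noteq> 0" using \<open>norm z < norm a\<close> by auto
    then have "- inverse a * (1 / (1 - z / a)) = 1 / (z - a)" using a0
      by (simp add: divide_simps)
    moreover have "- inverse a * (z / a) ^ n = - (inverse a ^ Suc n) * z powi int n" for n
      by (simp add: power_divide field_simps)
    ultimately show ?thesis by (simp only:)
  qed
  from laurent_le_has_sum[OF r laurent_le_monom[OF r] B this] show ?thesis by blast
next
  case False
  \<comment> \<open>Outside the annulus and with |a| \<le> r, the point satisfies |a| < 1/r. The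
    expansion below has only negative exponents, starting at -1.\<close>
  then have ar: "norm a * r < 1" using a r by (auto simp: annulus_def field_simps)
  have "((\<lambda>n. r * (norm a * r) ^ n) has_sum r * (1 / (1 - norm a * r))) UNIV"
    by (intro has_sum_cmult_right has_sum_geometric) (use ar r in auto)
  moreover have "r * (norm a * r) ^ n = norm (a ^ n) * r ^ nat \<bar>- int (Suc n)\<bar>" for n
    by (simp add: norm_power power_mult_distrib nat_add_distrib del: of_nat_Suc)
  ultimately have B: "((\<lambda>n. norm (a ^ n) * r ^ nat \<bar>- int (Suc n)\<bar>) has_sum
      r * (1 / (1 - norm a * r))) UNIV" by simp
  have "((\<lambda>n. a ^ n * z powi (- int (Suc n))) has_sum 1 / (z - a)) UNIV"
    if z: "z \<in> annulus r" for z
  proof -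
    have z0: "z \<noteq> 0" using annulus_nonzero z r by blast
    have "norm a < 1 / r" using ar r by (simp add: field_simps)
    then have "norm a < norm z" using z by (simp add: annulus_def)
    then have "((\<lambda>n. inverse z * (a / z) ^ n) has_sum inverse z * (1 / (1 - a / z))) UNIV"
      by (intro has_sum_cmult_right has_sum_geometric) (use z0 in \<open>auto simp: norm_divide\<close>)
    moreover have "z - a \<noteq> 0" using \<open>norm a < norm z\<close> by auto
    then have "inverse z * (1 / (1 - a / z)) = 1 / (z - a)" using z0
      by (simp add: divide_simps)
    moreover have "inverse z * (a / z) ^ n = a ^ n * z powi (- int (Suc n))" for n
      by (simp only: power_int_minus power_int_of_nat) (simp add: power_divide field_simps)
    ultimately show ?thesis by simp
  qed
  from laurent_le_has_sum[OF r laurent_le_monom[OF r] B this] show ?thesis by blast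
qed

text \<open>Induction on the degree, splitting off one root at a time by the fundamental theorem of
  algebra. Only the existence of some bound is claimed; the usable size comes from the Cauchy
  estimates.\<close>

lemma laurent_le_inverse_poly:
  assumes r: "r \<ge> 1" and "\<And>z. z \<in> annulus r \<Longrightarrow> poly p z \<noteq> 0"
  shows "\<exists>B. laurent_le r B (\<lambda>z. 1 / poly p z)"
  using assms(2)
proof (induction "degree p" arbitrary: p rule: less_induct)
  case less
  show ?case
  proof (cases "degree p = 0")
    case True
    then obtain a where "p = [:a:]" by (rule degree_eq_zeroE)
    then show ?thesis using laurent_le_const[OF r, of "1 / a"] by auto
  next
    case False
    then obtain a where a: "poly p a = 0"
      using fundamental_theorem_of_algebra[of p] constant_degree[of p] by auto
    then obtain q where q: "p = [:- a, 1:] * q" by (auto simp: poly_eq_0_iff_dvd elim: dvdE)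
    have "q \<noteq> 0" using q False by auto
    then have "degree q < degree p" unfolding q by (subst degree_mult_eq) auto
    moreover have "poly q z \<noteq> 0" if "z \<in> annulus r" for z using less.prems[OF that] q by auto
    ultimately obtain B where "laurent_le r B (\<lambda>z. 1 / poly q z)" using less.hyps by blast
    moreover have "a \<notin> annulus r" using a less.prems by blast
    then obtain A where "laurent_le r A (\<lambda>z. 1 / (z - a))" using laurent_le_inverse_linear[OF r] by blast
    ultimately have "laurent_le r (A * B) (\<lambda>z. 1 / (z - a) * (1 / poly q z))"
      by (intro laurent_le_mult r)
    moreover have "poly p z = (z - a) * poly q z" for z by (simp add: q algebra_simps)
    ultimately show ?thesis by auto
  qed
qed

section \<open>Cauchy estimates\<close>

text \<open>Finite partial sums come within \<open>e\<close> of the total, so little mass is left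
  outside a large finite set. \<open>K\<close> lets chosen indices be forced into \<open>F\<close>,
  such as that of a coefficient to be estimated.\<close>

lemma summable_on_small_tail:
  fixes c :: "'i \<Rightarrow> 'a::real_normed_vector"
  assumes c: "(\<lambda>n. norm (c n)) summable_on UNIV" and e: "e > 0" and K: "finite K"
  obtains F where "finite F" "K \<subseteq> F" "(\<Sum>\<^sub>\<infinity>n\<in>-F. norm (c n)) < e"
proof -
  define t where "t = (\<Sum>\<^sub>\<infinity>n. norm (c n))"
  have "((\<lambda>n. norm (c n)) has_sum t) UNIV" using c by (simp add: t_def)
  then have "eventually (\<lambda>F. (\<Sum>n\<in>F. norm (c n)) > t - e) (finite_subsets_at_top UNIV)"
    unfolding has_sum_def by (rule order_tendstoD) (use e in simp)
  then obtain F0 where F0: "finite F0" "\<And>F. finite F \<Longrightarrow> F0 \<subseteq> F \<Longrightarrow> (\<Sum>n\<in>F. norm (c n)) > t - e"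
    unfolding eventually_finite_subsets_at_top by auto
  define F where "F = F0 \<union> K"
  have F: "finite F" "F0 \<subseteq> F" using F0 K by (auto simp: F_def)
  have "t = (\<Sum>\<^sub>\<infinity>n\<in>F. norm (c n)) + (\<Sum>\<^sub>\<infinity>n\<in>-F. norm (c n))"
    unfolding t_def using infsum_Un_disjoint[of "\<lambda>n. norm (c n)" F "-F"]
      summable_on_subset_banach[OF c] by simp
  then have "(\<Sum>\<^sub>\<infinity>n\<in>-F. norm (c n)) < e" using F0(2)[OF F] F by simp
  then show ?thesis using that[of F] F by (auto simp: F_def)
qed

text \<open>Orthogonality of the characters of the circle, from the explicit antiderivative for
  nonzero exponents.\<close>

lemma has_integral_cis_powi:
  "((\<lambda>t. cis t powi m) has_integral (if m = 0 then 2 * pi else 0)) {0..2 * pi}"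
proof (cases "m = 0")
  case True
  then show ?thesis using has_integral_const_real[of "1::complex" 0 "2 * pi"]
    by (simp add: scaleR_conv_of_real)
next
  case False
  define h where "h t = exp (\<i> * of_int m * t) / (\<i> * of_int m)" for t
  have "((\<lambda>t. exp (\<i> * of_int m * complex_of_real t)) has_integral h (of_real (2 * pi)) - h (of_real 0)) {0..2 * pi}"
  proof (rule fundamental_theorem_of_calculus)
    fix x :: real
    have "(h has_field_derivative exp (\<i> * of_int m * complex_of_real x)) (at (of_real x))"
      unfolding h_def using False by (auto intro!: derivative_eq_intros)
    then show "((\<lambda>t. h (of_real t)) has_vector_derivative exp (\<i> * of_int m * complex_of_real x))
        (at x within {0..2 * pi})"
      by (rule has_vector_derivative_real_field)
  qed simp
  moreover have "exp (\<i> * of_int m * complex_of_real t) = cis t powi m" for t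
    by (simp add: cis_power_int) (simp add: cis_conv_exp mult_ac)
  moreover have "exp (\<i> * of_int m * complex_of_real (2 * pi)) = 1"
    by (subst exp_eq_1) (auto intro!: exI[of _ m])
  ultimately show ?thesis using False by (simp add: h_def)
qed

text \<open>The coefficient \<open>c k\<close> is the mean of \<open>g z * z powi (- k)\<close> over
  the circle. Integrating a finite truncation, at the price of an arbitrary \<open>e\<close>, avoids
  exchanging the integral with an infinite sum.\<close>

lemma laurent_coeff_le:
  fixes c :: "int \<Rightarrow> complex"
  assumes c: "(\<lambda>n. norm (c n)) summable_on UNIV"
    and g: "\<And>z. norm z = 1 \<Longrightarrow> ((\<lambda>n. c n * z powi n) has_sum g z) UNIV"
    and M: "\<And>z. norm z = 1 \<Longrightarrow> norm (g z) \<le> M"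
  shows "norm (c k) \<le> M"
proof (rule field_le_epsilon)
  fix e :: real assume "e > 0"
  then obtain F where F: "finite F" "{k} \<subseteq> F" and tail: "(\<Sum>\<^sub>\<infinity>n\<in>-F. norm (c n)) < e"
    using summable_on_small_tail[OF c, of e "{k}"] by auto
  \<comment> \<open>The truncated series divided by \<open>z powi k\<close>: its constant term is
    \<open>c k\<close>, and on the circle its modulus is that of the truncation.\<close>
  define h where "h z = (\<Sum>n\<in>F. c n * z powi (n - k))" for z
  have h: "norm (h z) \<le> M + e" if z: "norm z = 1" for z
  proof -
    have z0: "z \<noteq> 0" using z by auto
    have "((\<lambda>n. c n * z powi n) has_sum g z - (\<Sum>n\<in>F. c n * z powi n)) (UNIV - F)"
      by (rule has_sum_Diff[OF g[OF z] has_sum_finite[OF F(1)]]) auto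
    then have d: "((\<lambda>n. c n * z powi n) has_sum g z - (\<Sum>n\<in>F. c n * z powi n)) (-F)"
      by (simp add: Compl_eq_Diff_UNIV)
    have "norm (g z - (\<Sum>n\<in>F. c n * z powi n)) \<le> (\<Sum>\<^sub>\<infinity>n\<in>-F. norm (c n))"
      by (rule norm_infsum_le[OF d has_sum_infsum])
         (use summable_on_subset_banach[OF c] z in \<open>auto simp: norm_mult norm_power_int\<close>)
    then have "norm (\<Sum>n\<in>F. c n * z powi n) \<le> M + e"
      using M[OF z] tail norm_triangle_sub[of "\<Sum>n\<in>F. c n * z powi n" "g z"]
      by (simp add: norm_minus_commute)
    moreover have "h z = z powi (- k) * (\<Sum>n\<in>F. c n * z powi n)"
      unfolding h_def sum_distrib_left
      by (rule sum.cong) (simp_all add: z0 power_int_diff power_int_minus field_simps)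
    ultimately show ?thesis using z by (simp add: norm_mult norm_power_int)
  qed
  have "((\<lambda>t. h (cis t)) has_integral (\<Sum>n\<in>F. c n * (if n - k = 0 then 2 * pi else 0))) {0..2 * pi}"
    unfolding h_def by (intro has_integral_sum F has_integral_mult_right has_integral_cis_powi)
  also have "(\<Sum>n\<in>F. c n * (if n - k = 0 then 2 * pi else 0)) = (\<Sum>n\<in>F. if n = k then c n * (2 * pi) else 0)"
    by (rule sum.cong) auto
  also have "\<dots> = c k * (2 * pi)" using F by (simp add: sum.delta)
  finally have "((\<lambda>t. h (cis t)) has_integral c k * (2 * pi)) (cbox 0 (2 * pi))" by simp
  moreover have "0 \<le> M + e" using h[of 1] norm_ge_zero[of "h 1"] by (simp del: norm_ge_zero)
  ultimately have "norm (c k * (2 * pi)) \<le> (M + e) * measure lborel (cbox 0 (2 * pi))"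
    by (intro has_integral_bound[where f = "\<lambda>t. h (cis t)"] h) auto
  then show "norm (c k) \<le> M + e" by (simp add: norm_mult)
qed

lemma summable_on_int_geometric:
  fixes x :: real
  assumes "0 \<le> x" "x < 1"
  shows "(\<lambda>k::int. x ^ nat \<bar>k\<bar>) summable_on UNIV"
proof -
  have g: "(\<lambda>n. x ^ n) summable_on UNIV"
    using has_sum_geometric[of x] assms by (auto simp: summable_on_def)
  have "(\<lambda>k::int. x ^ nat \<bar>k\<bar>) summable_on range int"
    by (subst summable_on_reindex) (use g in \<open>auto simp: o_def\<close>)
  moreover have "(\<lambda>k::int. x ^ nat \<bar>k\<bar>) summable_on range (\<lambda>n. - int n)"
    by (subst summable_on_reindex) (use g in \<open>auto simp: o_def inj_on_def\<close>)
  moreover have "range int \<union> range (\<lambda>n. - int n) = UNIV"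
    by (auto simp: image_iff) (metis int_cases2)
  ultimately show ?thesis using summable_on_union by metis
qed

text \<open>Cauchy's estimates on the two boundary circles give |c_k| \<le> M r^(-|k|), and these
  bounds sum to a geometric constant. The new bound is governed by the sup norm \<open>M\<close>,
  which behaves well under powers.\<close>

lemma laurent_le_Cauchy:
  assumes r: "r > 1" and g: "laurent_le r B g"
    and M: "\<And>z. z \<in> annulus r \<Longrightarrow> norm (g z) \<le> M"
  shows "laurent_le 1 (M * (\<Sum>\<^sub>\<infinity>k::int. (1 / r) ^ nat \<bar>k\<bar>)) g"
proof -
  obtain c S where S: "((\<lambda>n::int. norm (c n) * r ^ nat \<bar>n\<bar>) has_sum S) UNIV" and
     c: "\<And>z. z \<in> annulus r \<Longrightarrow> ((\<lambda>n. c n * z powi n) has_sum g z) UNIV"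
    using g unfolding laurent_le_def by blast
  have S': "(\<lambda>n::int. norm (c n) * r ^ nat \<bar>n\<bar>) summable_on UNIV"
    using S by (auto simp: summable_on_def)
  \<comment> \<open>Rescaling by \<open>\<rho>\<close> moves a boundary circle to the unit circle,
    where the coefficient bound applies to z \<mapsto> g(\<rho> z).\<close>
  have bound: "norm (c k * of_real \<rho> powi k) \<le> M" if \<rho>: "\<rho> = r \<or> \<rho> = 1 / r" for k \<rho>
  proof (rule laurent_coeff_le)
    have *: "1 / r \<le> 1" using r by simp
    then have "1 / r \<le> r" using r by linarith
    have \<rho>': "complex_of_real \<rho> \<in> annulus r" "\<rho> > 0" "1 / r \<le> \<rho>" "\<rho> \<le> r"
      using \<rho> r * \<open>1 / r \<le> r\<close> by (auto simp: annulus_def)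
    show "(\<lambda>n. norm (c n * of_real \<rho> powi n)) summable_on UNIV"
      by (rule summable_on_comparison_test[OF S'])
         (use r norm_powi_annulus_le[OF _ \<rho>'(1)] in \<open>auto simp: norm_mult intro!: mult_left_mono\<close>)
    fix z :: complex assume z: "norm z = 1"
    have z': "of_real \<rho> * z \<in> annulus r" using z \<rho>' by (auto simp: annulus_def norm_mult)
    show "((\<lambda>n. c n * of_real \<rho> powi n * z powi n) has_sum g (of_real \<rho> * z)) UNIV"
      using c[OF z'] by (simp add: power_int_mult_distrib mult_ac)
    show "norm (g (of_real \<rho> * z)) \<le> M" using M[OF z'] .
  qed
  have ck: "norm (c k) * 1 ^ nat \<bar>k\<bar> \<le> M * (1 / r) ^ nat \<bar>k\<bar>" for k
  proof -
    have "norm (c k) * r ^ nat \<bar>k\<bar> \<le> M"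
    \<comment> \<open>The outer circle is the sharp choice for nonnegative \<open>k\<close>, the
      inner one for negative \<open>k\<close>.\<close>
    proof (cases "k \<ge> 0")
      case True
      then show ?thesis using bound[of r k] r by (simp add: norm_mult norm_power norm_power_int power_int_def)
    next
      case False
      then show ?thesis using bound[of "1 / r" k] r
        by (simp add: norm_mult norm_power norm_power_int power_int_def norm_divide)
    qed
    then show ?thesis using r by (simp add: field_simps)
  qed
  have geo: "((\<lambda>k::int. M * (1 / r) ^ nat \<bar>k\<bar>) has_sum M * (\<Sum>\<^sub>\<infinity>k::int. (1 / r) ^ nat \<bar>k\<bar>)) UNIV"
    by (intro has_sum_cmult_right has_sum_infsum summable_on_int_geometric) (use r in auto)
  have "(\<lambda>k. norm (c k) * 1 ^ nat \<bar>k\<bar>) summable_on UNIV"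
    by (rule summable_on_comparison_test[where f = "\<lambda>k. M * (1 / r) ^ nat \<bar>k\<bar>"])
       (use geo ck in \<open>auto simp: summable_on_def\<close>)
  then obtain U where U: "((\<lambda>k. norm (c k) * 1 ^ nat \<bar>k\<bar>) has_sum U) UNIV"
    by (auto simp: summable_on_def)
  have "U \<le> M * (\<Sum>\<^sub>\<infinity>k::int. (1 / r) ^ nat \<bar>k\<bar>)" using has_sum_mono[OF U geo] ck by blast
  moreover have "annulus 1 \<subseteq> annulus r" using r by (auto simp: annulus_def)
  ultimately show ?thesis unfolding laurent_le_def using U c by blast
qed

section \<open>Wiener's theorem for scalar functions\<close>

text \<open>Weierstrass M-test with the weighted coefficients as majorant. With \<open>r = 1\<close>
  it lets |f| attain its minimum on the circle.\<close>

lemma laurent_le_continuous: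
  assumes r: "r \<ge> 1" and f: "laurent_le r A f"
  shows "continuous_on (annulus r) f"
proof -
  obtain c S where S: "((\<lambda>n::int. norm (c n) * r ^ nat \<bar>n\<bar>) has_sum S) UNIV" and
     c: "\<And>z. z \<in> annulus r \<Longrightarrow> ((\<lambda>n. c n * z powi n) has_sum f z) UNIV"
    using f unfolding laurent_le_def by blast
  have "uniform_limit (annulus r) (\<lambda>F z. \<Sum>n\<in>F. c n * z powi n) (\<lambda>z. \<Sum>\<^sub>\<infinity>n. c n * z powi n)
      (finite_subsets_at_top UNIV)"
  proof (rule Weierstrass_m_test_general)
    show "norm (c n * z powi n) \<le> norm (c n) * r ^ nat \<bar>n\<bar>" if "z \<in> annulus r" for n z
      unfolding norm_mult by (intro mult_left_mono norm_powi_annulus_le r that) auto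
  qed (use S in \<open>auto simp: summable_on_def\<close>)
  then have "continuous_on (annulus r) (\<lambda>z. \<Sum>\<^sub>\<infinity>n. c n * z powi n)"
    by (rule uniform_limit_theorem[rotated])
       (auto intro!: always_eventually continuous_intros dest: annulus_nonzero[OF _ r])
  then show ?thesis
    by (rule continuous_on_eq) (use c in \<open>auto intro: infsumI\<close>)
qed

text \<open>Compactness of the circle gives one radius \<open>e\<close> for all its points, and the
  radial projection \<open>sgn z\<close> lies at distance | |z| - 1 | from \<open>z\<close>.\<close>

lemma annulus_subset_nbhd_circle:
  assumes "open U" "sphere 0 1 \<subseteq> U"
  obtains r where "r > 1" "annulus r \<subseteq> U"
proof -
  obtain e where e: "e > 0" "(\<Union>x\<in>sphere 0 1. cball x e) \<subseteq> U"
    using compact_subset_open_imp_cball_epsilon_subset[OF _ assms] by auto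
  have "annulus (1 + e) \<subseteq> U"
  proof
    fix z assume z: "z \<in> annulus (1 + e)"
    have z0: "z \<noteq> 0" using annulus_nonzero[OF z] e by auto
    \<comment> \<open>Because (1 - e)(1 + e) \<le> 1, the inner radius too is within
      \<open>e\<close> of 1.\<close>
    have "1 - e \<le> 1 / (1 + e)" using e by (simp add: field_simps)
    then have "1 - e \<le> norm z" "norm z \<le> 1 + e" using z by (auto simp: annulus_def)
    moreover have "z - sgn z = of_real (norm z - 1) * sgn z"
      using z0 by (simp add: sgn_eq field_simps)
    then have "norm (z - sgn z) = \<bar>norm z - 1\<bar>"
      using z0 by (simp add: norm_mult norm_sgn del: of_real_diff)
    ultimately have "dist (sgn z) z \<le> e" by (simp add: dist_norm norm_minus_commute)
    moreover have "sgn z \<in> sphere 0 1" using z0 by (simp add: norm_sgn)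
    ultimately show "z \<in> U" using e(2) by (meson UN_I mem_cball subsetD)
  qed
  then show ?thesis using that[of "1 + e"] e by auto
qed

text \<open>A spectral radius estimate: the constant \<open>C\<close> does not depend on
  \<open>n\<close>. The strict lower bound on |p| persists on a thin annulus, whose radius
  \<open>r\<close> fixes \<open>C\<close> as the sum of the r^(-|k|).\<close>

lemma laurent_le_inverse_poly_power:
  assumes "\<delta> > 0" and p: "\<And>z. norm z = 1 \<Longrightarrow> norm (poly p z) > \<delta>"
  obtains C where "\<And>n. laurent_le 1 (C * (1 / \<delta>) ^ n) (\<lambda>z. (1 / poly p z) ^ n)"
proof -
  have "open {z. norm (poly p z) > \<delta>}"
    by (intro open_Collect_less continuous_intros)
  then obtain r where r: "r > 1" "annulus r \<subseteq> {z. norm (poly p z) > \<delta>}"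
    by (rule annulus_subset_nbhd_circle) (use p in auto)
  then have p': "norm (poly p z) > \<delta>" if "z \<in> annulus r" for z using that by auto
  then have "poly p z \<noteq> 0" if "z \<in> annulus r" for z using assms(1) that by fastforce
  then obtain B where "laurent_le r B (\<lambda>z. 1 / poly p z)"
    using laurent_le_inverse_poly[of r p] r by auto
  \<comment> \<open>\<open>B ^ n\<close> may be far larger than \<open>(1 / \<delta>) ^ n\<close>;
    it serves to provide a Laurent expansion on the annulus, as the Cauchy estimate
    requires.\<close>
  then have "laurent_le r (B ^ n) (\<lambda>z. (1 / poly p z) ^ n)" for n
    using r by (intro laurent_le_power) auto
  moreover have "norm ((1 / poly p z) ^ n) \<le> (1 / \<delta>) ^ n" if "z \<in> annulus r" for z n
    unfolding norm_power using p'[OF that] assms(1)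
    by (intro power_mono) (auto simp: norm_divide intro!: divide_left_mono mult_pos_pos)
  ultimately have "laurent_le 1 ((1 / \<delta>) ^ n * (\<Sum>\<^sub>\<infinity>k::int. (1 / r) ^ nat \<bar>k\<bar>)) (\<lambda>z. (1 / poly p z) ^ n)" for n
    by (intro laurent_le_Cauchy[OF r(1)])
  then show ?thesis using that[of "\<Sum>\<^sub>\<infinity>k::int. (1 / r) ^ nat \<bar>k\<bar>"] by (simp add: mult.commute)
qed

text \<open>A truncation of the Laurent series is close in Wiener norm, and a power of
  \<open>z\<close> clears its negative exponents. On the unit circle that factor costs
  nothing.\<close>

lemma laurent_le_poly_approx:
  assumes f: "laurent_le 1 A f" and e: "e > 0"
  obtains p and m :: nat where "laurent_le 1 e (\<lambda>z. poly p z - z ^ m * f z)"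
proof -
  obtain c S where S: "((\<lambda>n::int. norm (c n) * 1 ^ nat \<bar>n\<bar>) has_sum S) UNIV" and
     c: "\<And>z. z \<in> annulus 1 \<Longrightarrow> ((\<lambda>n. c n * z powi n) has_sum f z) UNIV"
    using f unfolding laurent_le_def by blast
  have sc: "(\<lambda>n. norm (c n)) summable_on UNIV" using S by (auto simp: summable_on_def)
  obtain F where F: "finite F" and tail: "(\<Sum>\<^sub>\<infinity>n\<in>-F. norm (c n)) < e"
    using summable_on_small_tail[OF sc e, of "{}"] by auto
  define g where "g z = (\<Sum>n\<in>F. c n * z powi n) - f z" for z
  \<comment> \<open>Truncation minus \<open>f\<close> leaves just the negated tail of the
    series.\<close>
  define d where "d n = (if n \<in> F then 0 else - c n)" for n
  have "((\<lambda>n. norm (c n)) has_sum (\<Sum>\<^sub>\<infinity>n\<in>-F. norm (c n))) (-F)"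
    using summable_on_subset_banach[OF sc] by simp
  then have "((\<lambda>n. norm (d n) * 1 ^ nat \<bar>n\<bar>) has_sum (\<Sum>\<^sub>\<infinity>n\<in>-F. norm (c n))) UNIV"
    by (rule has_sum_cong_neutral[THEN iffD1, rotated -1]) (auto simp: d_def)
  moreover have "((\<lambda>n. d n * z powi n) has_sum g z) UNIV" if z: "z \<in> annulus 1" for z
  proof -
    have "((\<lambda>n. if n \<in> F then c n * z powi n else 0) has_sum (\<Sum>n\<in>F. c n * z powi n)) UNIV"
      by (rule has_sum_finite_neutralI[OF F]) auto
    from has_sum_add[OF this has_sum_uminusI[OF c[OF z]]] have "((\<lambda>n. (if n \<in> F then c n * z powi n else 0) - c n * z powi n) has_sum g z) UNIV"
      by (simp add: g_def)
    then show ?thesis by (rule has_sum_cong[THEN iffD1, rotated]) (auto simp: d_def)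
  qed
  ultimately have g: "laurent_le 1 e g" unfolding laurent_le_def using tail by (meson less_imp_le)
  \<comment> \<open>The largest exponent to be cleared; the inserted 0 covers an empty
    \<open>F\<close> and an \<open>F\<close> without negative exponents.\<close>
  define m where "m = nat (Max (insert 0 (uminus ` F)))"
  have m: "n + int m \<ge> 0" if "n \<in> F" for n
  proof -
    have "- n \<le> Max (insert 0 (uminus ` F))" using that F by (intro Max_ge) auto
    then show ?thesis by (simp add: m_def)
  qed
  define p where "p = (\<Sum>n\<in>F. monom (c n) (nat (n + int m)))"
  have "1 * z powi int m * g z = poly p z - z ^ m * f z" if z: "z \<in> annulus 1" for z
  proof -
    have z0: "z \<noteq> 0" using annulus_nonzero[OF z] by simp
    have "poly p z = (\<Sum>n\<in>F. c n * z powi (n + int m))"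
      unfolding p_def poly_sum by (rule sum.cong) (use m in \<open>auto simp: poly_monom power_int_def\<close>)
    also have "\<dots> = z ^ m * (\<Sum>n\<in>F. c n * z powi n)"
      unfolding sum_distrib_left by (rule sum.cong) (auto simp: power_int_add z0)
    finally show ?thesis by (simp add: g_def algebra_simps)
  qed
  moreover have "laurent_le 1 e (\<lambda>z. 1 * z powi int m * g z)"
    using laurent_le_monom_mult[OF _ g, of 1 "int m"] by simp
  ultimately have "laurent_le 1 e (\<lambda>z. poly p z - z ^ m * f z)"
    by (rule laurent_le_cong[rotated])
  then show ?thesis by (rule that)
qed

lemma wiener_inverse:
  assumes f: "laurent_le 1 A f" and nz: "\<And>z. norm z = 1 \<Longrightarrow> f z \<noteq> 0"
  shows "\<exists>B. laurent_le 1 B (\<lambda>z. 1 / f z)"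
proof -
  have "continuous_on (sphere 0 1) (\<lambda>z. norm (f z))"
    using laurent_le_continuous[OF _ f] by (auto simp: annulus_1 intro!: continuous_intros)
  then obtain z0 where z0: "norm z0 = 1" "\<And>z. norm z = 1 \<Longrightarrow> norm (f z0) \<le> norm (f z)"
    using continuous_attains_inf[of "sphere (0::complex) 1" "\<lambda>z. norm (f z)"] by auto
  \<comment> \<open>The 4 leaves room for two needs: |D| \<le> \<delta> gives |p| \<ge> 3\<delta>,
    strictly above 2\<delta>, and the series of norms then has ratio \<delta>/(2\<delta>) =
    1/2.\<close>
  define \<delta> where "\<delta> = norm (f z0) / 4"
  have \<delta>: "\<delta> > 0" using z0 nz by (simp add: \<delta>_def)
  have fd: "norm (f z) \<ge> 4 * \<delta>" if "norm z = 1" for z using z0(2)[OF that] by (simp add: \<delta>_def)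
  obtain p m where D: "laurent_le 1 \<delta> (\<lambda>z. poly p z - z ^ m * f z)"
    using laurent_le_poly_approx[OF f \<delta>] by blast
  define D where "D z = poly p z - z ^ m * f z" for z
  note D = D[folded D_def]
  have Dn: "norm (D z) \<le> \<delta>" if "norm z = 1" for z
    using laurent_le_norm[OF _ D, of z] that by (simp add: annulus_1)
  have pn: "norm (poly p z) > 2 * \<delta>" if z: "norm z = 1" for z
  proof -
    have "norm (z ^ m * f z) \<ge> 4 * \<delta>" using fd[OF z] z by (simp add: norm_mult norm_power)
    moreover have "norm (z ^ m * f z) \<le> norm (poly p z) + norm (D z)"
      using norm_triangle_ineq4[of "poly p z" "D z"] by (simp add: D_def)
    ultimately show ?thesis using Dn[OF z] \<delta> by linarith
  qed
  obtain C where C: "\<And>n. laurent_le 1 (C * (1 / (2 * \<delta>)) ^ n) (\<lambda>z. (1 / poly p z) ^ n)"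
    using laurent_le_inverse_poly_power[of "2 * \<delta>" p] pn \<delta> by auto
  have gn: "laurent_le 1 (\<delta> ^ n * (C * (1 / (2 * \<delta>)) ^ Suc n)) (\<lambda>z. D z ^ n * (1 / poly p z) ^ Suc n)" for n
    by (intro laurent_le_mult laurent_le_power D C) auto
  have "((\<lambda>n. C / (2 * \<delta>) * (1 / 2) ^ n) has_sum C / (2 * \<delta>) * (1 / (1 - 1 / 2))) UNIV"
    by (intro has_sum_cmult_right has_sum_geometric) auto
  moreover have "C / (2 * \<delta>) * (1 / 2) ^ n = \<delta> ^ n * (C * (1 / (2 * \<delta>)) ^ Suc n)" for n
    using \<delta> by (simp add: power_divide power_mult_distrib)
  ultimately have B: "((\<lambda>n. \<delta> ^ n * (C * (1 / (2 * \<delta>)) ^ Suc n)) has_sum C / (2 * \<delta>) * (1 / (1 - 1 / 2))) UNIV"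
    by (simp only:)
  have h: "((\<lambda>n. D z ^ n * (1 / poly p z) ^ Suc n) has_sum 1 / (z ^ m * f z)) UNIV"
    if "z \<in> annulus 1" for z
  proof -
    have z: "norm z = 1" using that by (simp add: annulus_1)
    have p0: "poly p z \<noteq> 0" using pn[OF z] \<delta> by auto
    have "norm (D z / poly p z) < 1"
      using pn[OF z] Dn[OF z] \<delta> p0 by (simp add: norm_divide)
    then have "((\<lambda>n. 1 / poly p z * (D z / poly p z) ^ n) has_sum 1 / poly p z * (1 / (1 - D z / poly p z))) UNIV"
      by (intro has_sum_cmult_right has_sum_geometric)
    moreover have "1 / poly p z * (D z / poly p z) ^ n = D z ^ n * (1 / poly p z) ^ Suc n" for n
      by (simp add: power_divide)
    moreover have "1 / poly p z * (1 / (1 - D z / poly p z)) = 1 / (poly p z - D z)"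
    proof -
      have "poly p z * (1 - D z / poly p z) = poly p z - D z"
        using p0 by (simp add: field_simps)
      then show ?thesis by simp
    qed
    moreover have "poly p z - D z = z ^ m * f z" by (simp add: D_def)
    ultimately show ?thesis by (simp only:)
  qed
  have "laurent_le 1 (C / (2 * \<delta>) * (1 / (1 - 1 / 2))) (\<lambda>z. 1 / (z ^ m * f z))"
    by (rule laurent_le_has_sum[OF _ gn B h]) auto
  \<comment> \<open>Multiplying by \<open>z powi int m\<close> turns the reciprocal of
    \<open>z ^ m * f z\<close> back into that of \<open>f z\<close>.\<close>
  then obtain B where "laurent_le 1 B (\<lambda>z. 1 * z powi int m * (1 / (z ^ m * f z)))"
    using laurent_le_monom_mult[of 1 _ _ 1 "int m"] by blast
  then have "laurent_le 1 B (\<lambda>z. 1 / f z)"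
    by (rule laurent_le_cong) (auto dest: annulus_nonzero)
  then show ?thesis by blast
qed

section \<open>Matrices and bicomplex numbers\<close>

text \<open>The Leibniz formula is a finite sum of finite products of entries.\<close>

lemma laurent_le_det:
  fixes F :: "complex \<Rightarrow> complex ^ 'p ^ 'p"
  assumes r: "r \<ge> 1" and "\<And>i j. \<exists>B. laurent_le r B (\<lambda>z. F z $ i $ j)"
  shows "\<exists>B. laurent_le r B (\<lambda>z. det (F z))"
proof -
  obtain B where B: "\<And>i j. laurent_le r (B i j) (\<lambda>z. F z $ i $ j)" using assms by metis
  have "laurent_le r (\<Sum>p\<in>{p. p permutes (UNIV :: 'p set)}. norm (of_int (sign p) :: complex) * (\<Prod>i\<in>UNIV. B i (p i)))
      (\<lambda>z. \<Sum>p\<in>{p. p permutes (UNIV :: 'p set)}. of_int (sign p) * (\<Prod>i\<in>UNIV. F z $ i $ p i))"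
    by (intro laurent_le_sum laurent_le_mult laurent_le_prod laurent_le_const r B)
       (auto simp: finite_permutations)
  then show ?thesis unfolding det_def by blast
qed

text \<open>Column \<open>j\<close> of \<open>B\<close> solves A x = e_j by Cramer's rule. The
  explicit form exhibits each entry as a determinant divided by \<open>det A\<close>, so inversion
  needs only one scalar reciprocal.\<close>

lemma cramer_inverse:
  fixes A :: "'a::field ^ 'n ^ 'n"
  assumes "invertible A"
  defines "B \<equiv> \<chi> i j. det (\<chi> a b. if b = i then if a = j then 1 else 0 else A $ a $ b) / det A"
  shows "A ** B = mat 1" "B ** A = mat 1"
proof -
  have "A *v column j B = axis j 1" for j
    using assms(1) by (subst cramer) (auto simp: invertible_det_nz vec_eq_iff column_def B_def axis_def
        cong: if_cong)
  then have "(A ** B) $ i $ j = axis j 1 $ i" for i j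
    by (metis (no_types, lifting) column_def matrix_matrix_mult_def matrix_vector_mult_def sum.cong vec_lambda_beta)
  then show "A ** B = mat 1" by (auto simp: vec_eq_iff mat_def axis_def)
  then show "B ** A = mat 1" by (simp add: matrix_left_right_inverse)
qed

lemma wiener_matrix_inverse:
  fixes F :: "complex \<Rightarrow> complex ^ 'p ^ 'p"
  assumes F: "\<And>i j. \<exists>B. laurent_le 1 B (\<lambda>z. F z $ i $ j)"
    and inv: "\<And>z. norm z = 1 \<Longrightarrow> invertible (F z)"
  obtains G where "\<And>i j. \<exists>B. laurent_le 1 B (\<lambda>z. G z $ i $ j)"
    "\<And>z. norm z = 1 \<Longrightarrow> F z ** G z = mat 1 \<and> G z ** F z = mat 1"
proof -
  define G where "G z = (\<chi> i j. det (\<chi> a b. if b = i then if a = j then 1 else 0 else F z $ a $ b) / det (F z))" for z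
  have "\<exists>B. laurent_le 1 B (\<lambda>z. G z $ i $ j)" for i j
  proof -
    obtain A where "laurent_le 1 A (\<lambda>z. det (F z))" using laurent_le_det[OF _ F] by auto
    from wiener_inverse[OF this] obtain B where B: "laurent_le 1 B (\<lambda>z. 1 / det (F z))"
      using inv by (auto simp: invertible_det_nz)
    have "\<exists>B. laurent_le 1 B (\<lambda>z. (\<chi> a b. if b = i then if a = j then 1 else 0 else F z $ a $ b) $ a $ b)" for a b
      using F[of a b] laurent_le_const[of 1] by (cases "b = i"; cases "a = j") auto
    then obtain C where "laurent_le 1 C (\<lambda>z. det (\<chi> a b. if b = i then if a = j then 1 else 0 else F z $ a $ b))"
      using laurent_le_det[of 1 "\<lambda>z. \<chi> a b. if b = i then if a = j then 1 else 0 else F z $ a $ b"] by auto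
    from laurent_le_mult[OF _ this B] show ?thesis by (auto simp: G_def)
  qed
  moreover have "F z ** G z = mat 1 \<and> G z ** F z = mat 1" if "norm z = 1" for z
    using cramer_inverse[OF inv[OF that]] by (simp add: G_def)
  ultimately show ?thesis using that by blast
qed

section \<open>Comparison of operator norms with entries, and entrywise sums\<close>

lemma norm_entry_le_onorm:
  fixes A :: "complex ^ 'n ^ 'm"
  shows "norm (A $ i $ j) \<le> onorm ((*v) A)"
proof -
  have "A $ i $ j = (A *v axis j 1) $ i"
    by (simp add: matrix_vector_mult_def axis_def if_distrib cong: if_cong)
  also have "norm \<dots> \<le> norm (A *v axis j 1)" by (rule Finite_Cartesian_Product.norm_nth_le)
  also have "\<dots> \<le> onorm ((*v) A) * norm (axis j (1::complex) :: complex ^ 'n)"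
    by (rule onorm) simp
  also have "norm (axis j (1::complex) :: complex ^ 'n) = 1"
    by (simp add: norm_vec_def L2_set_def axis_def if_distrib[of norm] if_distrib[of "\<lambda>x. x\<^sup>2"] cong: if_cong)
  finally show ?thesis by simp
qed

text \<open>With the preceding bound this makes summability in \<open>bc_mat_norm\<close> equivalent
  to absolute summability of both idempotent components of every entry.\<close>

lemma onorm_le_sum_entries:
  fixes A :: "complex ^ 'n ^ 'm"
  shows "onorm ((*v) A) \<le> (\<Sum>i\<in>UNIV. \<Sum>j\<in>UNIV. norm (A $ i $ j))"
proof (rule onorm_le)
  fix x :: "complex ^ 'n"
  have "norm (A *v x) \<le> (\<Sum>i\<in>UNIV. norm ((A *v x) $ i))"
    unfolding norm_vec_def by (rule L2_set_le_sum) auto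
  also have "\<dots> \<le> (\<Sum>i\<in>UNIV. \<Sum>j\<in>UNIV. norm (A $ i $ j) * norm x)"
    by (intro sum_mono)
       (auto simp: matrix_vector_mult_def norm_mult Finite_Cartesian_Product.norm_nth_le
         intro!: sum_norm_le mult_left_mono)
  finally show "norm (A *v x) \<le> (\<Sum>i\<in>UNIV. \<Sum>j\<in>UNIV. norm (A $ i $ j)) * norm x"
    by (simp add: sum_distrib_right)
qed

lemma has_sum_vecI:
  fixes x :: "'i \<Rightarrow> ('a::{comm_monoid_add,topological_space}) ^ 'n"
  assumes "\<And>i. ((\<lambda>n. x n $ i) has_sum s $ i) A"
  shows "(x has_sum s) A"
  using assms unfolding has_sum_def by (intro vec_tendstoI) simp

lemma summable_on_finite_sum:
  fixes x :: "'j \<Rightarrow> 'i \<Rightarrow> 'a::topological_comm_monoid_add"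
  assumes "finite J" "\<And>j. j \<in> J \<Longrightarrow> x j summable_on A"
  shows "(\<lambda>n. \<Sum>j\<in>J. x j n) summable_on A"
  using assms by (induction J rule: finite_induct) (auto intro: summable_on_add)

section \<open>Splitting into idempotent components and joining them again\<close>

lemma bounded_linear_bc_lambda: "bounded_linear bc_lambda1" "bounded_linear bc_lambda2"
  by (rule bounded_linear_intro[where K = 1]; simp add: norm_bicomplex_def)+

definition bc_join :: "complex \<Rightarrow> complex \<Rightarrow> bicomplex" where
  "bc_join x y = bc_of_complex x * bc_e1 + bc_of_complex y * bc_e2"

lemma bc_lambda_join [simp]: "bc_lambda1 (bc_join x y) = x" "bc_lambda2 (bc_join x y) = y"
  by (simp_all add: bc_join_def)

lemma has_sum_bc_join:
  assumes "(x has_sum a) I" "(y has_sum b) I"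
  shows "((\<lambda>n. bc_join (x n) (y n)) has_sum bc_join a b) I"
proof -
  have bl: "bounded_linear (\<lambda>x. bc_of_complex x * bc_e1)" "bounded_linear (\<lambda>x. bc_of_complex x * bc_e2)"
    by (rule bounded_linear_intro[where K = 1]; simp add: norm_bicomplex_def bicomplex_eq_iff_lambda)+
  show ?thesis unfolding bc_join_def
    by (rule has_sum_add[OF has_sum_bounded_linear[OF bl(1) assms(1)] has_sum_bounded_linear[OF bl(2) assms(2)]])
qed

text \<open>Negative exponents are the issue: \<open>inverse\<close> is componentwise at units, and
  on the bicomplex circle both components have modulus 1.\<close>

lemma bc_lambda_powi:
  assumes "Z \<in> bc_unit_circle"
  shows "bc_lambda1 (Z powi n) = bc_lambda1 Z powi n" "bc_lambda2 (Z powi n) = bc_lambda2 Z powi n"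
proof -
  have nz: "bc_lambda1 Z \<noteq> 0" "bc_lambda2 Z \<noteq> 0" using assms by (auto simp: bc_unit_circle_iff)
  have "inverse Z = bc_join (inverse (bc_lambda1 Z)) (inverse (bc_lambda2 Z))"
    by (rule bicomplex_inverse_unique) (simp add: bicomplex_eq_iff_lambda nz)
  moreover have "bc_lambda1 (W ^ m) = bc_lambda1 W ^ m" "bc_lambda2 (W ^ m) = bc_lambda2 W ^ m" for W m
    by (induction m) auto
  ultimately show "bc_lambda1 (Z powi n) = bc_lambda1 Z powi n" "bc_lambda2 (Z powi n) = bc_lambda2 Z powi n"
    by (simp_all add: power_int_def)
qed

lemma map_matrix_mult:
  fixes h :: "'a::semiring_1 \<Rightarrow> 'b::semiring_1" and A :: "'a ^ 'n ^ 'm" and B :: "'a ^ 'k ^ 'n"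
  assumes "\<And>x y. h (x + y) = h x + h y" "\<And>x y. h (x * y) = h x * h y" "h 0 = 0"
  shows "map_matrix h (A ** B) = map_matrix h A ** map_matrix h B"
proof -
  have "h (sum g I) = (\<Sum>i\<in>I. h (g i))" if "finite I" for g and I :: "'n set"
    using that by induction (auto simp: assms)
  then show ?thesis by (simp add: vec_eq_iff matrix_matrix_mult_def assms)
qed

lemma map_matrix_mat_1: "h 0 = 0 \<Longrightarrow> h 1 = 1 \<Longrightarrow> map_matrix h (mat 1) = mat 1"
  by (simp add: vec_eq_iff mat_def)

text \<open>\<open>L\<close> is a continuous ring homomorphism, so applying it termwise turns
  \<open>f\<close> into a complex matrix Laurent series in \<open>L Z\<close> alone, to which the
  complex theorem applies. Keeping \<open>L\<close> variable treats both components at once.\<close>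

lemma bc_wiener_component:
  fixes f :: "bicomplex \<Rightarrow> bicomplex ^ 'p ^ 'p"
  assumes f: "f \<in> bc_wiener" and inv: "\<forall>Z\<in>bc_unit_circle. invertible (f Z)"
    and L: "L = bc_lambda1 \<or> L = bc_lambda2"
  obtains G where "\<And>i j. \<exists>B. laurent_le 1 B (\<lambda>z. G z $ i $ j)"
    "\<And>Z. Z \<in> bc_unit_circle \<Longrightarrow>
      map_matrix L (f Z) ** G (L Z) = mat 1 \<and> G (L Z) ** map_matrix L (f Z) = mat 1"
proof -
  obtain a where a: "(\<lambda>n. bc_mat_norm (a n)) summable_on (UNIV :: int set)"
    and fa: "\<And>Z. Z \<in> bc_unit_circle \<Longrightarrow> ((\<lambda>n. map_matrix (\<lambda>x. x * (Z powi n)) (a n)) has_sum f Z) UNIV"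
    using f unfolding bc_wiener_def by blast
  have L_hom: "L (x + y) = L x + L y" "L (x * y) = L x * L y" "L 0 = 0" "L 1 = 1"
      "L (bc_of_complex z) = z" for x y z
    using L by auto
  have "bounded_linear L" using L bounded_linear_bc_lambda by auto
  then have bl: "bounded_linear (\<lambda>M. L (M $ i $ j))" for i j :: 'p
    by (rule bounded_linear_compose[OF _ bounded_linear_compose[OF bounded_linear_vec_nth bounded_linear_vec_nth]])
  have comp: "((\<lambda>n. L (a n $ i $ j) * L Z powi n) has_sum L (f Z $ i $ j)) UNIV"
    if "Z \<in> bc_unit_circle" for Z i j
    using has_sum_bounded_linear[OF bl fa[OF that], of i j] bc_lambda_powi[OF that] L
    by (auto simp: L_hom)
  \<comment> \<open>The embedded complex numbers serve as representatives:
    \<open>bc_of_complex z\<close> has both components equal to \<open>z\<close>.\<close>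
  define F where "F z = map_matrix L (f (bc_of_complex z))" for z
  have circ: "bc_of_complex z \<in> bc_unit_circle" if "norm z = 1" for z
    using that by (simp add: bc_unit_circle_iff)
  \<comment> \<open>\<open>Z\<close> and its representative give the same series under
    \<open>L\<close>, so uniqueness of sums identifies the values.\<close>
  have FL: "F (L Z) = map_matrix L (f Z)" if "Z \<in> bc_unit_circle" for Z
  proof -
    have "norm (L Z) = 1" using that L by (auto simp: bc_unit_circle_iff)
    note circ[OF this]
    then have "L (f (bc_of_complex (L Z)) $ i $ j) = L (f Z $ i $ j)" for i j
      using has_sum_unique[OF comp[of "bc_of_complex (L Z)" i j, unfolded L_hom] comp[OF that]] by blast
    then show ?thesis by (simp add: F_def vec_eq_iff)
  qed
  have "\<exists>B. laurent_le 1 B (\<lambda>z. F z $ i $ j)" for i j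
  proof -
    have on: "0 \<le> onorm ((*v) A)" for A :: "complex ^ 'p ^ 'p" by (rule onorm_pos_le) simp
    have "norm (L (a n $ i $ j)) \<le> bc_mat_norm (a n)" for n
      using L norm_entry_le_onorm[of "map_matrix bc_lambda1 (a n)" i j] on[of "map_matrix bc_lambda1 (a n)"]
        norm_entry_le_onorm[of "map_matrix bc_lambda2 (a n)" i j] on[of "map_matrix bc_lambda2 (a n)"]
      by (auto simp: bc_mat_norm_def)
    then have "(\<lambda>n. norm (L (a n $ i $ j)) * 1 ^ nat \<bar>n\<bar>) summable_on UNIV"
      by (intro summable_on_comparison_test[OF a]) auto
    moreover have "((\<lambda>n. L (a n $ i $ j) * z powi n) has_sum F z $ i $ j) UNIV" if "z \<in> annulus 1" for z
      using comp[OF circ, of z i j] that by (simp add: annulus_1 F_def L_hom)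
    ultimately show ?thesis unfolding laurent_le_def by (meson order_refl summable_on_def)
  qed
  moreover have "invertible (F z)" if "norm z = 1" for z
  proof -
    from inv circ[OF that] obtain B where
      "f (bc_of_complex z) ** B = mat 1" "B ** f (bc_of_complex z) = mat 1"
      unfolding invertible_def by blast
    from this[THEN arg_cong[where f = "map_matrix L"]] show ?thesis
      unfolding invertible_def F_def by (auto simp: map_matrix_mult map_matrix_mat_1 L_hom)
  qed
  ultimately obtain G where G: "\<And>i j. \<exists>B. laurent_le 1 B (\<lambda>z. G z $ i $ j)"
    "\<And>z. norm z = 1 \<Longrightarrow> F z ** G z = mat 1 \<and> G z ** F z = mat 1"
    using wiener_matrix_inverse[of F] by blast
  show ?thesis
  proof (rule that[OF G(1)])
    fix Z assume Z: "Z \<in> bc_unit_circle"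
    then have "norm (L Z) = 1" using L by (auto simp: bc_unit_circle_iff)
    from G(2)[OF this] show "map_matrix L (f Z) ** G (L Z) = mat 1 \<and> G (L Z) ** map_matrix L (f Z) = mat 1"
      by (simp add: FL[OF Z])
  qed
qed

lemma bc_matrix_eqI:
  assumes "map_matrix bc_lambda1 A = map_matrix bc_lambda1 B" "map_matrix bc_lambda2 A = map_matrix bc_lambda2 B"
  shows "A = B"
  using assms by (simp add: vec_eq_iff bicomplex_eq_iff_lambda)

text \<open>Joining the complex coefficients entrywise gives bicomplex ones, since multiplication by
  \<open>Z powi n\<close> acts on each component through that component of \<open>Z\<close>.\<close>

lemma bc_wiener_join:
  fixes G H :: "complex \<Rightarrow> complex ^ 'p ^ 'p"
  assumes "\<And>i j. \<exists>B. laurent_le 1 B (\<lambda>z. G z $ i $ j)" "\<And>i j. \<exists>B. laurent_le 1 B (\<lambda>z. H z $ i $ j)"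
  shows "(\<lambda>Z. \<chi> i j. bc_join (G (bc_lambda1 Z) $ i $ j) (H (bc_lambda2 Z) $ i $ j)) \<in> bc_wiener"
proof -
  have coeffs: "\<exists>c. (\<lambda>n. norm (c n)) summable_on UNIV \<and>
      (\<forall>z. norm z = 1 \<longrightarrow> ((\<lambda>n. c n * z powi n) has_sum g z) UNIV)"
    if "\<exists>B. laurent_le 1 B g" for g :: "complex \<Rightarrow> complex"
    using that unfolding laurent_le_def annulus_1 by (force simp: summable_on_def)
  obtain c where c: "\<And>i j. (\<lambda>n. norm (c i j n)) summable_on UNIV"
      "\<And>i j z. norm z = 1 \<Longrightarrow> ((\<lambda>n. c i j n * z powi n) has_sum G z $ i $ j) UNIV"
    using coeffs[OF assms(1)] by metis
  obtain d where d: "\<And>i j. (\<lambda>n. norm (d i j n)) summable_on UNIV"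
      "\<And>i j z. norm z = 1 \<Longrightarrow> ((\<lambda>n. d i j n * z powi n) has_sum H z $ i $ j) UNIV"
    using coeffs[OF assms(2)] by metis
  define b :: "int \<Rightarrow> bicomplex ^ 'p ^ 'p" where "b n = (\<chi> i j. bc_join (c i j n) (d i j n))" for n
  have on: "0 \<le> onorm ((*v) A)" for A :: "complex ^ 'p ^ 'p" by (rule onorm_pos_le) simp
  have "(\<lambda>n. bc_mat_norm (b n)) summable_on UNIV"
  proof (rule summable_on_comparison_test)
    show "(\<lambda>n. (\<Sum>i\<in>UNIV. \<Sum>j\<in>UNIV. norm (c i j n)) + (\<Sum>i\<in>UNIV. \<Sum>j\<in>UNIV. norm (d i j n))) summable_on UNIV"
      by (intro summable_on_add summable_on_finite_sum c d finite)
    show "bc_mat_norm (b n) \<le> (\<Sum>i\<in>UNIV. \<Sum>j\<in>UNIV. norm (c i j n)) + (\<Sum>i\<in>UNIV. \<Sum>j\<in>UNIV. norm (d i j n))" for n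
      using onorm_le_sum_entries[of "map_matrix bc_lambda1 (b n)"]
        onorm_le_sum_entries[of "map_matrix bc_lambda2 (b n)"]
      by (simp add: bc_mat_norm_def b_def)
    show "0 \<le> bc_mat_norm (b n)" for n using on by (simp add: bc_mat_norm_def)
  qed
  moreover have "((\<lambda>n. map_matrix (\<lambda>x. x * (Z powi n)) (b n)) has_sum
      (\<chi> i j. bc_join (G (bc_lambda1 Z) $ i $ j) (H (bc_lambda2 Z) $ i $ j))) UNIV"
    if Z: "Z \<in> bc_unit_circle" for Z
  proof (intro has_sum_vecI)
    fix i j
    have "bc_join (c i j n) (d i j n) * Z powi n
        = bc_join (c i j n * bc_lambda1 Z powi n) (d i j n * bc_lambda2 Z powi n)" for n
      using bc_lambda_powi[OF Z] by (simp add: bicomplex_eq_iff_lambda)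
    then show "((\<lambda>n. map_matrix (\<lambda>x. x * (Z powi n)) (b n) $ i $ j) has_sum
        (\<chi> i j. bc_join (G (bc_lambda1 Z) $ i $ j) (H (bc_lambda2 Z) $ i $ j)) $ i $ j) UNIV"
      using has_sum_bc_join[OF c(2) d(2)] Z by (simp add: b_def bc_unit_circle_iff)
  qed
  ultimately show ?thesis unfolding bc_wiener_def by blast
qed

theorem theorem1p21:
  fixes f :: "bicomplex \<Rightarrow> bicomplex ^ 'p ^ 'p"
  assumes "f \<in> bc_wiener"
    and "\<forall>Z\<in>bc_unit_circle. invertible (f Z)"
  shows "bc_wiener_invertible f"
proof -
  obtain G where G: "\<And>i j. \<exists>B. laurent_le 1 B (\<lambda>z. G z $ i $ j)"
    "\<And>Z. Z \<in> bc_unit_circle \<Longrightarrow> map_matrix bc_lambda1 (f Z) ** G (bc_lambda1 Z) = mat 1 \<and>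
       G (bc_lambda1 Z) ** map_matrix bc_lambda1 (f Z) = mat 1"
    using bc_wiener_component[OF assms, of bc_lambda1] by blast
  obtain H where H: "\<And>i j. \<exists>B. laurent_le 1 B (\<lambda>z. H z $ i $ j)"
    "\<And>Z. Z \<in> bc_unit_circle \<Longrightarrow> map_matrix bc_lambda2 (f Z) ** H (bc_lambda2 Z) = mat 1 \<and>
       H (bc_lambda2 Z) ** map_matrix bc_lambda2 (f Z) = mat 1"
    using bc_wiener_component[OF assms, of bc_lambda2] by blast
  \<comment> \<open>Matrix multiplication is componentwise, so joining the inverses of the two
    components inverts \<open>f Z\<close> itself.\<close>
  define g where "g Z = (\<chi> i j. bc_join (G (bc_lambda1 Z) $ i $ j) (H (bc_lambda2 Z) $ i $ j))" for Z
  have "g \<in> bc_wiener" unfolding g_def using bc_wiener_join[OF G(1) H(1)] .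
  moreover have "f Z ** g Z = mat 1 \<and> g Z ** f Z = mat 1" if "Z \<in> bc_unit_circle" for Z
  proof -
    have "map_matrix bc_lambda1 (g Z) = G (bc_lambda1 Z)" "map_matrix bc_lambda2 (g Z) = H (bc_lambda2 Z)"
      by (simp_all add: g_def vec_eq_iff)
    then show ?thesis using G(2)[OF that] H(2)[OF that]
      by (auto intro!: bc_matrix_eqI simp: map_matrix_mult map_matrix_mat_1)
  qed
  ultimately show ?thesis unfolding bc_wiener_invertible_def using assms(1) by blast
qed

end
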